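(* Let $m\in\mathbb{N}_0$. Then for all $x,y>0$: $$\beta^{(m)}(x+y)\le\beta^{(m)}(x)+\beta^{(m)}(y)\quad\text{if } m \text{ is even},$$ and $$\beta^{(m)}(x+y)\ge\beta^{(m)}(x)+\beta^{(m)}(y)\quad\text{if } m \text{ is odd}.$$
   Context: Nielsen's $\beta$-function is the function $\beta:(0,\infty)\to\mathbb{R}$ defined by $\beta(x)=\int_0^1 \frac{t^{x-1}}{1+t}\,dt=\int_0^\infty\frac{e^{-xt}}{1+e^{-t}}\,dt$ for $x>0$. For $m\in\mathbb{N}_0=\{0,1,2,\dots\}$, $\beta^{(m)}$ denotes its $m$-th derivative, with $\beta^{(0)}=\beta$. *)

theory Defs
  imports "HOL-Analysis.Analysis"
begin

text \<open>
  Nielsen's beta function is only meaningful for \<open>x > 0\<close>: for \<open>x \<le> 0\<close> the integral diverges and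
  the library's convention gives the value 0. Since (iterated) derivatives at a point depend
  only on the function near that point, the values for \<open>x \<le> 0\<close> do not affect the derivatives on
  the positive half-line. For \<open>0 < x < 1\<close> the integrand is unbounded at 0, and for \<open>x = 1\<close> the convention
  \<open>0 powr 0 = 0\<close> changes it at the single point 0; neither affects the integral.
\<close>

definition nielsen_beta :: "real \<Rightarrow> real" where
  "nielsen_beta x = integral {0..1} (\<lambda>t. t powr (x - 1) / (1 + t))"

end

theory Submission
  imports Defs "HOL-Real_Asymp.Real_Asymp"
begin

text \<open>
  The statement is a consequence of complete monotonicity: \<open>(-1)^m\<close> times the \<open>m\<close>-th derivative
  of \<open>\<beta>\<close> is nonnegative and nonincreasing on the positive half-line, and a function \<open>h\<close> with these
  two properties satisfies \<open>h (x + y) \<le> h x \<le> h x + h y\<close>.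

  Complete monotonicity is reached without differentiating under the integral sign. The function
  \<open>\<beta>\<close> is nonnegative and satisfies \<open>\<beta> x + \<beta> (x + 1) = 1 / x\<close>. These two properties determine
  it on the positive half-line (\<open>nonneg_reflection_unique\<close>), and the recurrence and monotonicity of
  the Digamma function \<open>\<psi>\<close> show that \<open>(\<psi> ((x + 1) / 2) - \<psi> (x / 2)) / 2\<close> has both of them. Hence
  \<open>\<beta>\<close> is this Digamma difference (\<open>nielsen_beta_eq_Digamma\<close>), its derivatives are the analogous
  differences of Polygamma functions, and their signs are read off from the monotonicity of the
  Polygamma functions, which alternates with the order.
\<close>

section \<open>Characterisation by a functional equation\<close>

text \<open>
  The difference of two solutions changes sign under \<open>x \<mapsto> x + 1\<close>, so its absolute value is
  \<open>1\<close>-periodic. Nonnegativity forces each solution below \<open>1 / x\<close>, so that absolute value also tends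
  to \<open>0\<close> along \<open>x + n\<close>, and hence vanishes.
\<close>

lemma nonneg_reflection_unique:
  fixes f g :: "real \<Rightarrow> real"
  assumes f_eq: "\<And>z. z > 0 \<Longrightarrow> f z + f (z + 1) = 1 / z"
    and g_eq: "\<And>z. z > 0 \<Longrightarrow> g z + g (z + 1) = 1 / z"
    and f_nonneg: "\<And>z. z > 0 \<Longrightarrow> f z \<ge> 0"
    and g_nonneg: "\<And>z. z > 0 \<Longrightarrow> g z \<ge> 0"
    and "x > 0"
  shows "f x = g x"
proof -
  have periodic: "\<bar>f (x + real n) - g (x + real n)\<bar> = \<bar>f x - g x\<bar>" for n
  proof (induction n)
    case (Suc n)
    have "f (x + real n + 1) - g (x + real n + 1) = - (f (x + real n) - g (x + real n))"
      using f_eq[of "x + real n"] g_eq[of "x + real n"] \<open>x > 0\<close> by linarith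
    then show ?case using Suc by (simp add: add_ac)
  qed simp
  have "\<bar>f x - g x\<bar> \<le> 1 / (x + real n)" for n
    using periodic[of n] f_eq[of "x + real n"] g_eq[of "x + real n"]
      f_nonneg[of "x + real n"] g_nonneg[of "x + real n"]
      f_nonneg[of "x + real n + 1"] g_nonneg[of "x + real n + 1"] \<open>x > 0\<close> by linarith
  moreover have "(\<lambda>n. 1 / (x + real n)) \<longlonglongrightarrow> 0"
    by real_asymp
  ultimately have "\<bar>f x - g x\<bar> \<le> 0"
    by (intro LIMSEQ_le_const) auto
  then show ?thesis by simp
qed

section \<open>The integral satisfies the functional equation\<close>

lemma nielsen_beta_integrable:
  assumes "x > 0"
  shows "(\<lambda>t::real. t powr (x - 1) / (1 + t)) integrable_on {0..1}"
proof -
  have "(\<lambda>t::real. t powr (x - 1)) absolutely_integrable_on {0..1}"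
    by (subst absolutely_integrable_on_iff_nonneg)
       (use assms in \<open>auto intro!: integrable_on_powr_from_0\<close>)
  moreover have cont: "continuous_on {0..1::real} (\<lambda>t. 1 / (1 + t))"
    by (intro continuous_intros) auto
  ultimately have "(\<lambda>t::real. 1 / (1 + t) * t powr (x - 1)) absolutely_integrable_on {0..1}"
    by (intro absolutely_integrable_bounded_measurable_product_real
          continuous_imp_measurable_on_sets_lebesgue compact_imp_bounded
          compact_continuous_image) auto
  then show ?thesis
    by (simp add: set_lebesgue_integral_eq_integral(1))
qed

lemma nielsen_beta_nonneg:
  assumes "x > 0"
  shows "nielsen_beta x \<ge> 0"
  unfolding nielsen_beta_def
  by (intro integral_nonneg nielsen_beta_integrable assms) auto

text \<open>The factor \<open>1 + t\<close> cancels from the sum of the two integrands, which leaves \<open>t powr (x - 1)\<close>.\<close>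

lemma nielsen_beta_plus1:
  assumes "x > 0"
  shows "nielsen_beta x + nielsen_beta (x + 1) = 1 / x"
proof -
  have sum: "t powr (x - 1) / (1 + t) + t powr (x + 1 - 1) / (1 + t) = t powr (x - 1)"
    if "t \<in> {0..1}" for t :: real
  proof -
    have "t powr x = t * t powr (x - 1)"
      using that powr_mult_base[of t "x - 1"] by simp
    then have "t powr (x - 1) / (1 + t) + t powr (x + 1 - 1) / (1 + t) =
        (1 + t) * t powr (x - 1) / (1 + t)"
      by (simp add: add_divide_distrib distrib_right)
    then show ?thesis using that by simp
  qed
  have "nielsen_beta x + nielsen_beta (x + 1) =
      integral {0..1} (\<lambda>t. t powr (x - 1) / (1 + t) + t powr (x + 1 - 1) / (1 + t))"
    unfolding nielsen_beta_def using assms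
    by (intro integral_add[symmetric] nielsen_beta_integrable) auto
  also have "\<dots> = integral {0..1} (\<lambda>t. t powr (x - 1))"
    by (intro integral_cong sum)
  also have "\<dots> = 1 / x"
    using has_integral_powr_from_0[of "x - 1" 1] assms by (simp add: integral_unique)
  finally show ?thesis .
qed

section \<open>Differences of Polygamma functions\<close>

definition Polygamma_diff :: "nat \<Rightarrow> real \<Rightarrow> real" where
  "Polygamma_diff m x = (Polygamma m ((x + 1) / 2) - Polygamma m (x / 2)) / 2 ^ (m + 1)"

lemma Polygamma_diff_sign:
  assumes "x > 0"
  shows "(-1) ^ m * Polygamma_diff m x \<ge> 0"
proof (cases "even m")
  case True
  then show ?thesis
    using Polygamma_real_strict_mono[of "x / 2" "(x + 1) / 2" m] assms
    by (simp add: Polygamma_diff_def)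
next
  case False
  then show ?thesis
    using Polygamma_real_strict_antimono[of "x / 2" "(x + 1) / 2" m] assms
    by (simp add: Polygamma_diff_def divide_simps)
qed

lemma Polygamma_diff_has_derivative:
  assumes "x > 0"
  shows "(Polygamma_diff m has_real_derivative Polygamma_diff (Suc m) x) (at x)"
proof -
  have "(x + 1) / 2 \<notin> \<int>\<^sub>\<le>\<^sub>0" "x / 2 \<notin> \<int>\<^sub>\<le>\<^sub>0"
    using assms by (auto elim!: nonpos_Ints_cases)
  then show ?thesis
    unfolding Polygamma_diff_def [abs_def]
    by (auto intro!: derivative_eq_intros simp: field_simps)
qed

lemma Polygamma_diff_decreasing:
  assumes "0 < x" "x \<le> y"
  shows "(-1) ^ m * Polygamma_diff m y \<le> (-1) ^ m * Polygamma_diff m x"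
proof (rule DERIV_nonpos_imp_nonincreasing[OF \<open>x \<le> y\<close>])
  fix z assume "x \<le> z" "z \<le> y"
  then have "z > 0" using assms by simp
  then have "((\<lambda>z. (-1) ^ m * Polygamma_diff m z) has_real_derivative
      (-1) ^ m * Polygamma_diff (Suc m) z) (at z)"
    by (intro DERIV_cmult Polygamma_diff_has_derivative)
  moreover have "(-1) ^ m * Polygamma_diff (Suc m) z \<le> 0"
    using Polygamma_diff_sign[OF \<open>z > 0\<close>, of "Suc m"] by simp
  ultimately show "\<exists>D. ((\<lambda>z. (-1) ^ m * Polygamma_diff m z) has_real_derivative D) (at z) \<and> D \<le> 0"
    by blast
qed

text \<open>
  Moving from \<open>x\<close> to \<open>x + 1\<close> shifts the arguments by a half, so the sum telescopes to
  \<open>(\<psi> (x / 2 + 1) - \<psi> (x / 2)) / 2\<close>, which the recurrence for \<open>\<psi>\<close> evaluates.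
\<close>

lemma Polygamma_diff_0_plus1:
  assumes "x > 0"
  shows "Polygamma_diff 0 x + Polygamma_diff 0 (x + 1) = 1 / x"
proof -
  have "(x + 1 + 1) / 2 = x / 2 + 1" by simp
  then show ?thesis
    using Digamma_plus1[of "x / 2"] assms by (simp add: Polygamma_diff_def field_simps)
qed

section \<open>Derivatives of Nielsen's beta function\<close>

lemma nielsen_beta_eq_Digamma:
  assumes "x > 0"
  shows "nielsen_beta x = Polygamma_diff 0 x"
  using nielsen_beta_plus1 Polygamma_diff_0_plus1 nielsen_beta_nonneg _ assms
proof (rule nonneg_reflection_unique)
  fix z :: real assume "z > 0"
  then show "Polygamma_diff 0 z \<ge> 0"
    using Polygamma_diff_sign[of z 0] by simp
qed

lemma higher_deriv_nielsen_beta: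
  assumes "x > 0"
  shows "(deriv ^^ m) nielsen_beta x = Polygamma_diff m x"
  using assms
proof (induction m arbitrary: x)
  case 0
  then show ?case by (simp add: nielsen_beta_eq_Digamma)
next
  case (Suc m)
  have "eventually (\<lambda>z. z > 0) (nhds x)"
    using Suc.prems by (intro eventually_nhds_in_open[of "{0<..}", simplified]) auto
  then have "eventually (\<lambda>z. (deriv ^^ m) nielsen_beta z = Polygamma_diff m z) (nhds x)"
    by eventually_elim (rule Suc.IH)
  then have "deriv ((deriv ^^ m) nielsen_beta) x = deriv (Polygamma_diff m) x"
    by (rule deriv_cong_ev) simp
  also have "\<dots> = Polygamma_diff (Suc m) x"
    by (intro DERIV_imp_deriv Polygamma_diff_has_derivative Suc.prems)
  finally show ?case by simp
qed

theorem theorem2p16: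
  fixes m :: nat and x y :: real
  assumes "x > 0" and "y > 0"
  shows "(even m \<longrightarrow>
           (deriv ^^ m) nielsen_beta (x + y) \<le> (deriv ^^ m) nielsen_beta x + (deriv ^^ m) nielsen_beta y) \<and>
         (odd m \<longrightarrow>
           (deriv ^^ m) nielsen_beta (x + y) \<ge> (deriv ^^ m) nielsen_beta x + (deriv ^^ m) nielsen_beta y)"
proof -
  have "(-1) ^ m * Polygamma_diff m (x + y) \<le> (-1) ^ m * Polygamma_diff m x"
    using assms by (intro Polygamma_diff_decreasing) auto
  moreover have "(-1) ^ m * Polygamma_diff m y \<ge> 0"
    using assms by (intro Polygamma_diff_sign)
  ultimately show ?thesis
    using assms by (auto simp: higher_deriv_nielsen_beta)
qed

end
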